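(* Let $q>2$ be a prime power. If there exists an $[n,k]_{q^2}$ GRS code with $l$-dimensional Hermitian hull, where $0\le l\le k$, then for any $1\le i\le\min\{l,n-k\}$ and each $0\le s\le l-i$ there exists an $[n,k+i]_{q^2}$ MDS code with $s$-dimensional Hermitian hull.
   Context: For a linear code $\mathcal C\subseteq\mathbb F_{q^2}^n$, $\mathcal C^{\perp_H}=\{\bm x:\sum_i y_ix_i^q=0\ \text{for all }\bm y\in\mathcal C\}$, and the Hermitian hull is $\mathrm{Hull}_H(\mathcal C)=\mathcal C\cap\mathcal C^{\perp_H}$. An $[n,k]_{q^2}$ GRS code ($1\le k\le n$) is a code $\{(v_1f(a_1),\dots,v_nf(a_n)):f\in\mathbb F_{q^2}[x],\deg f\le k-1\}$ with distinct $a_j\in\mathbb F_{q^2}$ and $v_j\in\mathbb F_{q^2}^*$. An $[n,k]$ code is MDS if its minimum distance is $n-k+1$. *)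

theory Defs
  imports
    "HOL-Analysis.Cartesian_Space"
    "HOL-Computational_Algebra.Polynomial"
    "HOL-Number_Theory.Prime_Powers"
begin

text \<open>
  The coordinates of a code are indexed by a finite type, so the length is its cardinality.
  The parameter \<open>q\<close> is meant to be the square root of the order of the field, so that
  \<open>x \<mapsto> x ^ q\<close> is the conjugation of the field over its subfield of order \<open>q\<close>.
\<close>

definition linear_code :: "nat \<Rightarrow> nat \<Rightarrow> ('a::field ^ 'n) set \<Rightarrow> bool" where
  "linear_code n k C \<longleftrightarrow> CARD('n) = n \<and> vec.subspace C \<and> vec.dim C = k"

definition hermitian_dual :: "nat \<Rightarrow> ('a::field ^ 'n) set \<Rightarrow> ('a ^ 'n) set" where
  "hermitian_dual q C = {x. \<forall>y\<in>C. (\<Sum>i\<in>UNIV. y $ i * (x $ i) ^ q) = 0}"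

definition hermitian_hull :: "nat \<Rightarrow> ('a::field ^ 'n) set \<Rightarrow> ('a ^ 'n) set" where
  "hermitian_hull q C = C \<inter> hermitian_dual q C"

definition hamming_dist :: "'a ^ 'n \<Rightarrow> 'a ^ 'n \<Rightarrow> nat" where
  "hamming_dist x y = card {i. x $ i \<noteq> y $ i}"

text \<open>Only meaningful for codes with at least two codewords; otherwise the set is empty.\<close>

definition min_distance :: "('a ^ 'n) set \<Rightarrow> nat" where
  "min_distance C = Min {hamming_dist x y | x y. x \<in> C \<and> y \<in> C \<and> x \<noteq> y}"

definition mds_code :: "nat \<Rightarrow> nat \<Rightarrow> ('a::field ^ 'n) set \<Rightarrow> bool" where
  "mds_code n k C \<longleftrightarrow> linear_code n k C \<and> min_distance C = n - k + 1"

definition grs_code :: "nat \<Rightarrow> nat \<Rightarrow> ('a::field ^ 'n) set \<Rightarrow> bool" where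
  "grs_code n k C \<longleftrightarrow> CARD('n) = n \<and> 1 \<le> k \<and> k \<le> n \<and>
     (\<exists>(a :: 'n \<Rightarrow> 'a) v. inj a \<and> (\<forall>j. v j \<noteq> 0) \<and>
        C = {(\<chi> j. v j * poly f (a j)) | f. degree f \<le> k - 1})"

end

theory Submission
  imports "HOL-Number_Theory.Residues" Defs
begin

text \<open>
  Allowing degree one higher enlarges a GRS code by a single vector, and the vectors of the old
  hull orthogonal to it lie in the new hull; so the GRS code of dimension \<open>k + i\<close> with the same
  evaluation points and multipliers has a hull of dimension at least \<open>l - i\<close>. Multiplying one
  suitable multiplier by an element whose norm is not 1, which exists for \<open>q > 2\<close>, lowers the
  dimension of the hull by exactly one, and this is repeated until it equals \<open>s\<close>.
\<close>

section \<open>Finite fields\<close>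

text \<open>Multiplication by a nonzero \<open>x\<close> permutes the nonzero elements, so it leaves
  their product unchanged.\<close>

lemma finite_field_power_card:
  fixes x :: "'a::{field,finite}"
  shows "x ^ CARD('a) = x"
proof (cases "x = 0")
  case False
  let ?U = "UNIV - {0 :: 'a}"
  have "bij_betw ((*) x) ?U ?U"
    using False by (intro bij_betwI[of _ _ _ "\<lambda>y. y / x"]) auto
  then have "\<Prod>?U = (\<Prod>y\<in>?U. x * y)"
    using prod.reindex_bij_betw[of "(*) x" ?U ?U "\<lambda>y. y"] by simp
  also have "\<dots> = x ^ (CARD('a) - 1) * \<Prod>?U"
    by (simp add: prod.distrib card_Diff_singleton)
  finally have "x ^ (CARD('a) - 1) = 1"
    by simp
  moreover have "x ^ CARD('a) = x * x ^ (CARD('a) - 1)"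
    by (metis power_eq_if zero_less_card_finite less_irrefl)
  ultimately show ?thesis
    by simp
qed (simp add: power_0_left)

section \<open>The Hermitian form\<close>

definition hermitian_form :: "nat \<Rightarrow> 'a::field ^ 'n \<Rightarrow> 'a ^ 'n \<Rightarrow> 'a" where
  "hermitian_form q x y = (\<Sum>j\<in>UNIV. x $ j * (y $ j) ^ q)"

lemma hermitian_form_add: "hermitian_form q (x + y) z = hermitian_form q x z + hermitian_form q y z"
  by (simp add: hermitian_form_def distrib_right sum.distrib)

lemma hermitian_form_scale: "hermitian_form q (c *s x) z = c * hermitian_form q x z"
  by (simp add: hermitian_form_def sum_distrib_left mult.assoc)

text \<open>Rank-nullity for a functional that is nonzero somewhere on \<open>S\<close>. It is
  applied to pairing with a fixed vector and to reading off one coordinate.\<close>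

lemma dim_kernel_functional:
  fixes S :: "('a::field ^ 'n) set"
  assumes S: "vec.subspace S" and u: "u \<in> S" "f u \<noteq> 0"
    and add: "\<And>x y. f (x + y) = f x + f y" and scale: "\<And>c x. f (c *s x) = c * f x"
  shows "vec.dim S = vec.dim {x \<in> S. f x = 0} + 1"
proof -
  let ?K = "{x \<in> S. f x = 0}"
  have f0: "f 0 = 0"
    using scale[of 0 0] by simp
  have K: "vec.subspace ?K"
    using S by (auto simp: vec.subspace_def add scale f0)
  have "S \<subseteq> vec.span (insert u ?K)"
  proof
    fix x assume x: "x \<in> S"
    \<comment> \<open>Chosen so that adding \<open>c *s u\<close> moves \<open>x\<close> into the
      kernel.\<close>
    define c where "c = - (f x / f u)"
    have "x + c *s u \<in> S"
      by (intro vec.subspace_add vec.subspace_scale S x u)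
    moreover have "f (x + c *s u) = 0"
      unfolding add scale c_def using u by simp
    ultimately have "x + c *s u \<in> vec.span (insert u ?K)"
      by (simp add: vec.span_base)
    moreover have "c *s u \<in> vec.span (insert u ?K)"
      by (simp add: vec.span_base vec.span_scale)
    ultimately show "x \<in> vec.span (insert u ?K)"
      using vec.span_diff by fastforce
  qed
  moreover have "vec.span (insert u ?K) \<subseteq> S"
    using S u by (intro vec.span_minimal) auto
  ultimately have "S = vec.span (insert u ?K)"
    by auto
  then have "vec.dim S = vec.dim (insert u ?K)"
    by (metis vec.dim_span)
  also have "\<dots> = vec.dim ?K + 1"
    using K u by (simp add: vec.dim_insert vec.span_eq_iff[THEN iffD2])
  finally show ?thesis .
qed

context
  fixes q :: nat
  assumes q: "primepow q" and card: "CARD('a::{field,finite}) = q ^ 2"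
begin

text \<open>\<open>q\<close> is a power of the characteristic, so the map is an iterated
  Frobenius.\<close>

lemma conjugation_sum: "(\<Sum>j\<in>A. f j) ^ q = (\<Sum>j\<in>A. (f j :: 'a) ^ q)"
proof -
  have prime: "prime CHAR('a)"
    by (intro prime_CHAR_semidom finite_imp_CHAR_pos) simp
  obtain p m where pm: "prime p" "q = p ^ m"
    using q by (auto simp: primepow_def)
  have "CHAR('a) dvd q ^ 2"
    using CHAR_dvd_CARD[where ?'a = 'a] card by simp
  then have "CHAR('a) = p"
    using prime pm by (metis prime_dvd_power primes_dvd_imp_eq)
  then show ?thesis
    using freshmans_dream_sum'[OF prime, of q m f A] pm by simp
qed

lemma conjugation_involution: "((x :: 'a) ^ q) ^ q = x"
  using finite_field_power_card[of x] card by (simp add: power2_eq_square flip: power_mult)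

lemma hermitian_form_swap: "hermitian_form q (x :: 'a ^ 'n) y = hermitian_form q y x ^ q"
  by (simp add: hermitian_form_def conjugation_sum power_mult_distrib conjugation_involution mult.commute)

lemma primepow_nonzero: "q \<noteq> 0"
  using q by (auto simp: primepow_def dest: prime_gt_0_nat)

text \<open>The dual puts \<open>x\<close> in the conjugated slot. The swap moves it to the linear
  slot, where closure under addition and scaling is immediate.\<close>

lemma mem_hermitian_hull:
  "(x :: 'a ^ 'n) \<in> hermitian_hull q C \<longleftrightarrow> x \<in> C \<and> (\<forall>y\<in>C. hermitian_form q x y = 0)"
proof -
  have "hermitian_form q x y = 0 \<longleftrightarrow> hermitian_form q y x = 0" for y
    using hermitian_form_swap[of x y] primepow_nonzero by simp
  then show ?thesis
    by (auto simp: hermitian_hull_def hermitian_dual_def hermitian_form_def)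
qed

lemma subspace_hermitian_hull:
  "vec.subspace (C :: ('a ^ 'n) set) \<Longrightarrow> vec.subspace (hermitian_hull q C)"
  by (auto simp: vec.subspace_def mem_hermitian_hull hermitian_form_add hermitian_form_scale)
     (simp add: hermitian_form_def)

section \<open>Changing the hull\<close>

text \<open>A vector of the old hull that is orthogonal to \<open>u\<close> is orthogonal to all of
  \<open>D\<close>. Orthogonality to \<open>u\<close> is one linear condition, so it costs at most
  one dimension.\<close>

lemma dim_hermitian_hull_insert:
  fixes C D :: "('a ^ 'n) set"
  assumes C: "vec.subspace C" and CD: "C \<subseteq> D"
    and D: "\<And>y. y \<in> D \<Longrightarrow> \<exists>c. \<exists>z\<in>C. y = z + c *s u"
  shows "vec.dim (hermitian_hull q C) \<le> vec.dim (hermitian_hull q D) + 1"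
proof -
  let ?K = "{x \<in> hermitian_hull q C. hermitian_form q x u = 0}"
  have "?K \<subseteq> hermitian_hull q D"
  proof
    fix x assume x: "x \<in> ?K"
    have "hermitian_form q x y = 0" if y: "y \<in> D" for y
    proof -
      obtain c z where z: "z \<in> C" "y = z + c *s u"
        using D[OF y] by blast
      have "hermitian_form q z x = 0" "hermitian_form q u x = 0"
        using x z hermitian_form_swap[of z x] hermitian_form_swap[of u x] primepow_nonzero
        by (auto simp: mem_hermitian_hull power_0_left)
      then show ?thesis
        using hermitian_form_swap[of x y] primepow_nonzero z
        by (simp add: hermitian_form_add hermitian_form_scale power_0_left)
    qed
    then show "x \<in> hermitian_hull q D"
      using x CD by (auto simp: mem_hermitian_hull)
  qed
  then have le: "vec.dim ?K \<le> vec.dim (hermitian_hull q D)"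
    by (rule vec.dim_subset)
  show ?thesis
  \<comment> \<open>Pairing with \<open>u\<close> may vanish on the whole old hull; then no
    dimension is lost.\<close>
  proof (cases "\<exists>x\<in>hermitian_hull q C. hermitian_form q x u \<noteq> 0")
    case True
    then obtain x where "x \<in> hermitian_hull q C" "hermitian_form q x u \<noteq> 0"
      by blast
    then have "vec.dim (hermitian_hull q C) = vec.dim ?K + 1"
      by (intro dim_kernel_functional subspace_hermitian_hull C)
         (auto simp: hermitian_form_add hermitian_form_scale)
    then show ?thesis
      using le by simp
  next
    case False
    then have "?K = hermitian_hull q C"
      by blast
    then show ?thesis
      using le by simp
  qed
qed

lemma exists_norm_neq_1:
  assumes "q > 2"
  shows "\<exists>w :: 'a. w \<noteq> 0 \<and> w * w ^ q \<noteq> 1"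
proof (rule ccontr)
  assume "\<not> ?thesis"
  then have *: "w = 0 \<or> w ^ (q + 1) = 1" for w :: 'a
    by auto
  \<comment> \<open>This is X * (X^(q+1) - 1); the factor X makes 0 a root too, so all q^2 elements
    are roots. For q = 2 the degree q + 2 equals q^2 and there is no contradiction.\<close>
  define p :: "'a poly" where "p = monom 1 (q + 2) - monom 1 1"
  have "coeff p 1 = - 1"
    using assms by (simp add: p_def)
  then have "p \<noteq> 0"
    by auto
  have "poly p w = 0" for w
    using *[of w] by (auto simp: p_def poly_monom)
  then have "CARD('a) \<le> degree p"
    using card_poly_roots_bound[OF \<open>p \<noteq> 0\<close>] by simp
  also have "\<dots> \<le> q + 2"
    unfolding p_def by (intro degree_diff_le) (auto intro: order.trans[OF degree_monom_le])
  finally have "q * q \<le> q + 2"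
    using card by (simp add: power2_eq_square)
  moreover have "3 * q \<le> q * q"
    using assms by (intro mult_right_mono) auto
  ultimately show False
    using assms by linarith
qed

text \<open>
  Rescaling a coordinate where some vector of the hull does not vanish adds a rank one term
  to the form; testing against that vector shows that the new hull consists of the vectors
  of the old hull vanishing there.
\<close>

lemma hermitian_hull_rescale:
  fixes C :: "('a ^ 'n) set"
  assumes "q > 2" and C: "vec.subspace C" and dim: "vec.dim (hermitian_hull q C) = Suc h"
  obtains w :: "'n \<Rightarrow> 'a" where "\<And>j. w j \<noteq> 0"
    and "vec.dim (hermitian_hull q ((\<lambda>x. \<chi> j. w j * x $ j) ` C)) = h"
proof -
  let ?H = "hermitian_hull q C"
  have "\<not> ?H \<subseteq> {0}"
    using dim by (metis vec.dim_eq_0 nat.distinct(1))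
  then obtain u where u: "u \<in> ?H" "u \<noteq> 0"
    by blast
  then obtain j0 where j0: "u $ j0 \<noteq> 0"
    by (auto simp: vec_eq_iff)
  obtain b :: 'a where b: "b \<noteq> 0" "b * b ^ q \<noteq> 1"
    using exists_norm_neq_1 assms(1) by blast
  define w where "w j = (if j = j0 then b else 1)" for j
  define T where "T x = (\<chi> j. w j * x $ j)" for x :: "'a ^ 'n"
  have w: "w j \<noteq> 0" for j
    using b by (simp add: w_def)
  have form: "hermitian_form q (T x) (T y) =
      hermitian_form q x y + (b * b ^ q - 1) * (x $ j0 * (y $ j0) ^ q)" for x y
  proof -
    have "hermitian_form q (T x) (T y) = (\<Sum>j\<in>UNIV. x $ j * (y $ j) ^ q +
        (if j = j0 then (b * b ^ q - 1) * (x $ j0 * (y $ j0) ^ q) else 0))"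
      unfolding hermitian_form_def
      by (intro sum.cong) (auto simp: T_def w_def power_mult_distrib algebra_simps)
    then show ?thesis
      by (simp add: sum.distrib hermitian_form_def)
  qed
  let ?K = "{x \<in> ?H. x $ j0 = 0}"
  have hull: "hermitian_hull q (T ` C) = T ` ?K"
  proof (intro equalityI subsetI)
    fix t assume t: "t \<in> hermitian_hull q (T ` C)"
    then obtain x where x: "x \<in> C" "t = T x"
      by (auto simp: mem_hermitian_hull)
    have *: "hermitian_form q x y + (b * b ^ q - 1) * (x $ j0 * (y $ j0) ^ q) = 0" if "y \<in> C" for y
      using t that x form[of x y] by (auto simp: mem_hermitian_hull)
    have "hermitian_form q x u = 0"
      using u x hermitian_form_swap[of x u] primepow_nonzero
      by (simp add: mem_hermitian_hull power_0_left)
    then have "x $ j0 = 0"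
      using *[of u] u j0 b by (auto simp: mem_hermitian_hull)
    then show "t \<in> T ` ?K"
      using * x by (auto simp: mem_hermitian_hull)
  next
    fix t assume "t \<in> T ` ?K"
    then show "t \<in> hermitian_hull q (T ` C)"
      by (auto simp: mem_hermitian_hull form)
  qed
  have "Vector_Spaces.linear (*s) (*s) T"
    by unfold_locales (auto simp: T_def vec_eq_iff algebra_simps)
  moreover have "inj T"
    using w by (auto simp: inj_def T_def vec_eq_iff)
  ultimately have "vec.dim (T ` ?K) = vec.dim ?K"
    by (intro vec.dim_image_eq) (auto intro: inj_on_subset)
  \<comment> \<open>Since \<open>u\<close> lies in the hull and is nonzero at \<open>j0\<close>, the
    drop is exactly one.\<close>
  moreover have "vec.dim ?H = vec.dim ?K + 1"
    using dim_kernel_functional[of ?H u "\<lambda>x. x $ j0"] subspace_hermitian_hull[OF C] u(1) j0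
    by simp
  ultimately have "vec.dim (hermitian_hull q (T ` C)) = h"
    using dim hull by simp
  then show ?thesis
    using that[of w] w by (simp add: T_def[abs_def])
qed

end

section \<open>Generalized Reed-Solomon codes\<close>

text \<open>Bounding the coefficients instead of the degree makes \<open>k = 0\<close> the zero
  code, from which the induction on the dimension starts. With \<open>degree f \<le> k - 1\<close>,
  truncated subtraction would admit constants there.\<close>

definition grs :: "('n \<Rightarrow> 'a::field) \<Rightarrow> ('n \<Rightarrow> 'a) \<Rightarrow> nat \<Rightarrow> ('a ^ 'n) set" where
  "grs a v k = {(\<chi> j. v j * poly f (a j)) | f. \<forall>m\<ge>k. coeff f m = 0}"

lemma coeff_vanish_iff_degree:
  "1 \<le> k \<Longrightarrow> (\<forall>m\<ge>k. coeff f m = 0) \<longleftrightarrow> degree f \<le> k - 1"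
  by (metis Suc_diff_1 Suc_le_eq coeff_eq_0 degree_le le_less_trans less_eq_Suc_le zero_less_one
      order.strict_trans2 diff_less)

lemma subspace_grs: "vec.subspace (grs a v k)"
  unfolding vec.subspace_def
proof (intro conjI ballI allI)
  show "0 \<in> grs a v k"
    by (auto simp: grs_def vec_eq_iff intro!: exI[of _ 0])
next
  fix x y assume "x \<in> grs a v k" "y \<in> grs a v k"
  then obtain f g where "x = (\<chi> j. v j * poly f (a j))" "\<forall>m\<ge>k. coeff f m = 0"
    and "y = (\<chi> j. v j * poly g (a j))" "\<forall>m\<ge>k. coeff g m = 0"
    by (auto simp: grs_def)
  then show "x + y \<in> grs a v k"
    by (auto simp: grs_def vec_eq_iff algebra_simps intro!: exI[of _ "f + g"])
next
  fix c x assume "x \<in> grs a v k"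
  then obtain f where "x = (\<chi> j. v j * poly f (a j))" "\<forall>m\<ge>k. coeff f m = 0"
    by (auto simp: grs_def)
  then show "c *s x \<in> grs a v k"
    by (auto simp: grs_def vec_eq_iff algebra_simps intro!: exI[of _ "smult c f"])
qed

lemma grs_mono: "grs a v k \<subseteq> grs a v (Suc k)"
  by (auto simp: grs_def)

text \<open>Subtract the term of degree \<open>k\<close> from the polynomial.\<close>

lemma grs_Suc_decompose:
  assumes "y \<in> grs a v (Suc k)"
  shows "\<exists>c. \<exists>z\<in>grs a v k. y = z + c *s (\<chi> j. v j * a j ^ k)"
proof -
  obtain f where f: "y = (\<chi> j. v j * poly f (a j))" "\<forall>m\<ge>Suc k. coeff f m = 0"
    using assms by (auto simp: grs_def)
  let ?g = "f - monom (coeff f k) k"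
  have "\<forall>m\<ge>k. coeff ?g m = 0"
  proof (intro allI impI)
    fix m assume "m \<ge> k"
    then show "coeff ?g m = 0"
      using f(2) by (cases "m = k") auto
  qed
  then have "(\<chi> j. v j * poly ?g (a j)) \<in> grs a v k"
    unfolding grs_def by blast
  moreover have "y = (\<chi> j. v j * poly ?g (a j)) + coeff f k *s (\<chi> j. v j * a j ^ k)"
    by (simp add: f(1) vec_eq_iff poly_monom algebra_simps)
  ultimately show ?thesis
    by blast
qed

text \<open>Rescaling coordinates only changes the multipliers, so the code stays GRS with the same
  evaluation points.\<close>

lemma grs_rescale: "(\<lambda>x. \<chi> j. w j * x $ j) ` grs a v k = grs a (\<lambda>j. w j * v j) k"
proof -
  have "grs a v k = (\<lambda>f. \<chi> j. v j * poly f (a j)) ` {f. \<forall>m\<ge>k. coeff f m = 0}" for v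
    by (auto simp: grs_def)
  then show ?thesis
    by (simp add: image_image mult.assoc)
qed

section \<open>Dimension and minimum distance of GRS codes\<close>

lemma card_zeros_grs:
  fixes a :: "'n::finite \<Rightarrow> 'a::field"
  assumes "inj a" "f \<noteq> 0"
  shows "card {j. poly f (a j) = 0} \<le> degree f"
proof -
  have "card {j. poly f (a j) = 0} = card (a ` {j. poly f (a j) = 0})"
    using assms by (intro card_image[symmetric]) (auto intro: inj_on_subset)
  also have "\<dots> \<le> card {x. poly f x = 0}"
    using assms by (intro card_mono poly_roots_finite) auto
  also have "\<dots> \<le> degree f"
    using assms card_poly_roots_bound by blast
  finally show ?thesis .
qed

context
  fixes a v :: "'n::finite \<Rightarrow> 'a::field"
  assumes a: "inj a" and v: "\<And>j. v j \<noteq> 0"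
begin

text \<open>Otherwise X^k - f would be a nonzero polynomial of degree at most \<open>k\<close> with
  more than \<open>k\<close> roots.\<close>

lemma monomial_not_in_grs:
  assumes "k < CARD('n)"
  shows "(\<chi> j. v j * a j ^ k) \<notin> grs a v k"
proof
  assume "(\<chi> j. v j * a j ^ k) \<in> grs a v k"
  then obtain f where f: "\<forall>m\<ge>k. coeff f m = 0" "\<And>j. poly f (a j) = a j ^ k"
    using v by (auto simp: grs_def vec_eq_iff)
  let ?g = "monom 1 k - f"
  have "coeff ?g k = 1"
    using f by simp
  then have "?g \<noteq> 0"
    by auto
  then have "CARD('n) \<le> degree ?g"
    using card_zeros_grs[OF a, of ?g] f by (simp add: poly_monom)
  also have "\<dots> \<le> k"
    using f by (intro degree_le) auto
  finally show False
    using assms by simp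
qed

lemma dim_grs: "k \<le> CARD('n) \<Longrightarrow> vec.dim (grs a v k) = k"
proof (induction k)
  case 0
  have "grs a v 0 \<subseteq> {0}"
  proof
    fix x assume "x \<in> grs a v 0"
    then obtain f where f: "x = (\<chi> j. v j * poly f (a j))" "\<forall>m. coeff f m = 0"
      by (auto simp: grs_def)
    then have "f = 0"
      by (intro poly_eqI) simp
    then show "x \<in> {0}"
      by (simp add: f(1) vec_eq_iff)
  qed
  then show ?case
    by simp
next
  case (Suc k)
  let ?u = "\<chi> j. v j * a j ^ k"
  have u: "?u \<in> grs a v (Suc k)"
    by (auto simp: grs_def vec_eq_iff poly_monom intro!: exI[of _ "monom 1 k"])
  have "grs a v (Suc k) = vec.span (insert ?u (grs a v k))"
  proof
    show "grs a v (Suc k) \<subseteq> vec.span (insert ?u (grs a v k))"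
    proof
      fix y assume "y \<in> grs a v (Suc k)"
      then obtain c z where "z \<in> grs a v k" "y = z + c *s ?u"
        using grs_Suc_decompose by blast
      then show "y \<in> vec.span (insert ?u (grs a v k))"
        by (simp add: vec.span_add vec.span_scale vec.span_base)
    qed
    show "vec.span (insert ?u (grs a v k)) \<subseteq> grs a v (Suc k)"
      using u grs_mono by (intro vec.span_minimal subspace_grs) auto
  qed
  then have "vec.dim (grs a v (Suc k)) = vec.dim (insert ?u (grs a v k))"
    by (metis vec.dim_span)
  also have "\<dots> = Suc k"
    using Suc monomial_not_in_grs[of k] subspace_grs[of a v k]
    by (simp add: vec.dim_insert vec.span_eq_iff[THEN iffD2])
  finally show ?case .
qed

text \<open>Codewords agree exactly where the difference of their polynomials vanishes, hence in at
  most \<open>k - 1\<close> places.\<close>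

lemma hamming_dist_grs:
  assumes k: "1 \<le> k" "k \<le> CARD('n)" and xy: "x \<in> grs a v k" "y \<in> grs a v k" "x \<noteq> y"
  shows "CARD('n) - k + 1 \<le> hamming_dist x y"
proof -
  obtain f g where f: "x = (\<chi> j. v j * poly f (a j))" "\<forall>m\<ge>k. coeff f m = 0"
    and g: "y = (\<chi> j. v j * poly g (a j))" "\<forall>m\<ge>k. coeff g m = 0"
    using xy by (auto simp: grs_def)
  have "f - g \<noteq> 0"
    using xy(3) f g by auto
  then have "card {j. poly (f - g) (a j) = 0} \<le> degree (f - g)"
    by (rule card_zeros_grs[OF a])
  also have "\<dots> \<le> k - 1"
    using f g k coeff_vanish_iff_degree[of k "f - g"] by simp
  finally have "card {j. poly (f - g) (a j) = 0} \<le> k - 1" .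
  moreover have "{j. poly (f - g) (a j) = 0} = - {j. x $ j \<noteq> y $ j}"
    using v by (auto simp: f g)
  ultimately show ?thesis
    using k by (simp add: hamming_dist_def Compl_eq_Diff_UNIV card_Diff_subset)
qed

lemma exists_hamming_dist_grs:
  assumes k: "1 \<le> k" "k \<le> CARD('n)"
  shows "\<exists>x\<in>grs a v k. hamming_dist x 0 = CARD('n) - k + 1"
proof -
  have "k - 1 \<le> CARD('n)"
    using k by simp
  then obtain J :: "'n set" where J: "card J = k - 1"
    by (rule obtain_subset_with_card_n)
  \<comment> \<open>By injectivity of \<open>a\<close>, this vanishes at exactly the
    \<open>k - 1\<close> evaluation points indexed by \<open>J\<close>, so the distance bound is
    attained.\<close>
  define f where "f = (\<Prod>i\<in>J. [:- a i, 1:])"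
  have "degree f = k - 1"
    using J by (simp add: f_def degree_prod_sum_eq)
  then have "(\<chi> j. v j * poly f (a j)) \<in> grs a v k"
    using coeff_vanish_iff_degree[of k f] k by (auto simp: grs_def)
  moreover have "poly f (a j) = 0 \<longleftrightarrow> j \<in> J" for j
    using a by (auto simp: f_def poly_prod inj_def)
  then have "{j. v j * poly f (a j) \<noteq> 0} = - J"
    using v by auto
  then have "hamming_dist (\<chi> j. v j * poly f (a j)) 0 = CARD('n) - k + 1"
    using J k by (simp add: hamming_dist_def Compl_eq_Diff_UNIV card_Diff_subset)
  ultimately show ?thesis
    by blast
qed

lemma mds_grs:
  assumes k: "1 \<le> k" "k \<le> CARD('n)"
  shows "mds_code CARD('n) k (grs a v k)"
proof -
  let ?S = "{hamming_dist x y | x y. x \<in> grs a v k \<and> y \<in> grs a v k \<and> x \<noteq> y}"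
  have "Min ?S = CARD('n) - k + 1"
  proof (rule Min_eqI)
    have "?S \<subseteq> {..CARD('n)}"
      by (auto simp: hamming_dist_def intro: card_mono)
    then show "finite ?S"
      by (rule finite_subset) simp
    show "CARD('n) - k + 1 \<le> d" if "d \<in> ?S" for d
      using that k hamming_dist_grs by blast
    obtain x where x: "x \<in> grs a v k" "hamming_dist x 0 = CARD('n) - k + 1"
      using exists_hamming_dist_grs k by blast
    \<comment> \<open>The distance from \<open>x\<close> to 0 is positive, so the pair
      \<open>x\<close>, 0 is admissible in \<open>?S\<close>.\<close>
    then have "x \<noteq> 0"
      by (auto simp: hamming_dist_def)
    moreover have "0 \<in> grs a v k"
      using subspace_grs vec.subspace_0 by blast
    ultimately show "CARD('n) - k + 1 \<in> ?S"
      using x by (smt (verit) mem_Collect_eq)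
  qed
  then show ?thesis
    using k by (simp add: mds_code_def linear_code_def min_distance_def dim_grs subspace_grs)
qed

end

section \<open>Hulls of GRS codes\<close>

lemma grs_code_iff:
  fixes C :: "('a::field ^ 'n) set"
  shows "grs_code n k C \<longleftrightarrow> CARD('n) = n \<and> 1 \<le> k \<and> k \<le> n \<and>
    (\<exists>a v. inj a \<and> (\<forall>j. v j \<noteq> 0) \<and> C = grs a v k)"
proof (cases "1 \<le> k")
  case True
  then show ?thesis
    unfolding grs_code_def grs_def coeff_vanish_iff_degree[OF True] by blast
qed (simp add: grs_code_def)

lemma dim_hermitian_hull_grs_add:
  fixes a v :: "'n::finite \<Rightarrow> 'a::{field,finite}"
  assumes "primepow q" and "CARD('a) = q ^ 2"
  shows "vec.dim (hermitian_hull q (grs a v k)) \<le> vec.dim (hermitian_hull q (grs a v (k + i))) + i"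
proof (induction i)
  case (Suc i)
  have "vec.dim (hermitian_hull q (grs a v (k + i)))
      \<le> vec.dim (hermitian_hull q (grs a v (Suc (k + i)))) + 1"
    by (rule dim_hermitian_hull_insert[OF assms subspace_grs grs_mono grs_Suc_decompose])
  then show ?case
    using Suc by simp
qed simp

text \<open>Descending induction from the actual hull dimension to \<open>s\<close>: each rescaling
  lowers it by one and is absorbed into the multipliers.\<close>

lemma exists_grs_hull_dim:
  fixes a v :: "'n::finite \<Rightarrow> 'a::{field,finite}"
  assumes "primepow q" and "CARD('a) = q ^ 2" and "q > 2"
    and "\<And>j. v j \<noteq> 0" and "s \<le> vec.dim (hermitian_hull q (grs a v k))"
  shows "\<exists>v'. (\<forall>j. v' j \<noteq> 0) \<and> vec.dim (hermitian_hull q (grs a v' k)) = s"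
  using assms(5)
proof (induction s rule: inc_induct)
  case base
  then show ?case
    using assms by blast
next
  case (step s)
  then obtain v' where v': "\<And>j. v' j \<noteq> 0" "vec.dim (hermitian_hull q (grs a v' k)) = Suc s"
    by blast
  obtain w where "\<And>j. w j \<noteq> 0"
      "vec.dim (hermitian_hull q ((\<lambda>x. \<chi> j. w j * x $ j) ` grs a v' k)) = s"
    using hermitian_hull_rescale[OF assms(1-3) subspace_grs v'(2)] by blast
  then show ?case
    using v' by (intro exI[of _ "\<lambda>j. w j * v' j"]) (simp add: grs_rescale)
qed

theorem corollary4:
  fixes q n k l i s :: nat
  assumes "primepow q" and "q > 2"
    and "CARD('a::{field,finite}) = q ^ 2"
    and "l \<le> k"
    and "\<exists>C :: ('a ^ 'n) set. grs_code n k C \<and> vec.dim (hermitian_hull q C) = l"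
    and "1 \<le> i" and "i \<le> min l (n - k)"
    and "s \<le> l - i"
  shows "\<exists>D :: ('a ^ 'n) set. mds_code n (k + i) D \<and> vec.dim (hermitian_hull q D) = s"
proof -
  obtain a v :: "'n \<Rightarrow> 'a" where n: "CARD('n) = n" "1 \<le> k" "k \<le> n"
    and a: "inj a" and v: "\<And>j. v j \<noteq> 0" and l: "vec.dim (hermitian_hull q (grs a v k)) = l"
    using assms(5) by (auto simp: grs_code_iff)
  have "s \<le> vec.dim (hermitian_hull q (grs a v (k + i)))"
    using dim_hermitian_hull_grs_add[OF assms(1,3), of a v k i] l assms(8) by linarith
  then obtain v' where v': "\<And>j. v' j \<noteq> 0" "vec.dim (hermitian_hull q (grs a v' (k + i))) = s"
    using exists_grs_hull_dim[OF assms(1,3,2), of v s a "k + i"] v by blast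
  \<comment> \<open>This is where \<open>i \<le> n - k\<close> enters: the enlarged code must still
    fit into length \<open>n\<close> to have dimension \<open>k + i\<close> and be MDS.\<close>
  have "k + i \<le> n"
    using n assms(7) by linarith
  then have "mds_code n (k + i) (grs a v' (k + i))"
    using mds_grs[OF a, of v' "k + i"] v' n by simp
  then show ?thesis
    using v' by blast
qed

end
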